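(* Let $L:[a,b]\times\mathbb{R}^d\times\mathbb{R}^d\to\mathbb{R}$, $(t,x,v)\mapsto L(t,x,v)$, be an admissible Lagrangian function, and let $\mathcal{L}_\Delta(X)=[J_\Delta(L(T,X,\Delta X))]_N$ be the discrete $\Delta$ Lagrangian functional on $C(\mathbb{T},\mathbb{R}^d)$ associated to $L$. A discrete function $X\in C(\mathbb{T},\mathbb{R}^d)$ is a critical point of $\mathcal{L}_\Delta$ if and only if it satisfies the discrete Euler-Lagrange equation $$\nabla\left(\frac{\partial L}{\partial v}(T,X,\Delta X)\right)=\frac{\partial L}{\partial x}(T,X,\Delta X)\quad\text{over } \mathbb{T}^{\pm}.$$
   Context: Let $a<b$ be real numbers, $N\ge 1$ and $d\ge 1$ integers, $h=(b-a)/N$, $t_k=a+kh$ for $k=0,\dots,N$, $\mathbb{T}=\{t_0,\dots,t_N\}$, $\mathbb{T}_+=\{t_0,\dots,t_{N-1}\}$, $\mathbb{T}^{\pm}=\mathbb{T}\setminus\{t_0,t_N\}$. For a finite set $S$, $C(S,\mathbb{R}^d)$ is the set of all functions $S\to\mathbb{R}^d$; write $X_k=X(t_k)$. $T\in C(\mathbb{T},\mathbb{R})$ is given by $T_k=t_k$. A Lagrangian is a function $L:[a,b]\times\mathbb{R}^d\times\mathbb{R}^d\to\mathbb{R}$, written $L(t,x,v)$. The word "admissible" is the source's own term for its hypothesis on $L$; the source gives no definition of it and states no explicit regularity condition. The statement itself presupposes that the partial derivatives $\partial L/\partial x$ and $\partial L/\partial v$ exist, and the source's proof uses the first-order Taylor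 expansion of $L$ in $(x,v)$. $\Delta X\in C(\mathbb{T}_+,\mathbb{R}^d)$ is $(\Delta X)_k=(X_{k+1}-X_k)/h$ for $0\le k\le N-1$. For $Y$ defined on $\mathbb{T}_+$, $(\nabla Y)_k=(Y_k-Y_{k-1})/h$ for $1\le k\le N-1$. For a function $F$ on $\mathbb{T}_+$, $[J_\Delta F]_N=\sum_{i=0}^{N-1}hF_i$. Thus $\mathcal{L}_\Delta(X)=\sum_{k=0}^{N-1}h\,L\big(t_k,X_k,(\Delta X)_k\big)$. The expressions $\frac{\partial L}{\partial v}(T,X,\Delta X)$ and $\frac{\partial L}{\partial x}(T,X,\Delta X)$ are the functions on $\mathbb{T}_+$ whose value at $t_k$ is the corresponding ($\mathbb{R}^d$-valued) partial gradient of $L$ at $(t_k,X_k,(\Delta X)_k)$. Discrete variations are the elements of $C_0(\mathbb{T},\mathbb{R}^d)=\{H\in C(\mathbb{T},\mathbb{R}^d):H_0=H_N=0\}$. The derivative along $H$ is $\mathcal{D}\mathcal{L}_\Delta(X)(H)=\lim_{\epsilon\to0}\frac{1}{\epsilon}\big(\mathcal{L}_\Delta(X+\epsilon H)-\mathcal{L}_\Delta(X)\big)$, and $X$ is a critical point of $\mathcal{L}_\Delta$ if $\mathcal{D}\mathcal{L}_\Delta(X)(H)=0$ for all $H\in C_0(\mathbb{T},\mathbb{R}^d)$. *)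

theory Defs
  imports "HOL-Analysis.Analysis"
begin

text \<open>
  A discrete function on the grid t_0, ..., t_N is represented by the sequence of its values
  X_k = X(t_k), so \<^term>\<open>X k\<close> stands for X(t_k). Functions on the first N grid points
  (resp. on the N - 1 interior ones) are sequences of which only the indices k < N
  (resp. 1 \<le> k < N) matter. No definition below looks at the value of a sequence outside
  its range of meaningful indices (see the note on the backward difference).
\<close>

definition grid_step :: "real \<Rightarrow> real \<Rightarrow> nat \<Rightarrow> real" where
  "grid_step a b N = (b - a) / real N"

definition grid_point :: "real \<Rightarrow> real \<Rightarrow> nat \<Rightarrow> nat \<Rightarrow> real" where
  "grid_point a b N k = a + real k * grid_step a b N"

definition delta_diff :: "real \<Rightarrow> (nat \<Rightarrow> 'v::real_vector) \<Rightarrow> nat \<Rightarrow> 'v" where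
  "delta_diff h X k = (X (Suc k) - X k) /\<^sub>R h"

text \<open>Only meaningful for k \<ge> 1: at k = 0 the truncated index \<^term>\<open>k - 1\<close> gives the value 0.\<close>

definition nabla_diff :: "real \<Rightarrow> (nat \<Rightarrow> 'v::real_vector) \<Rightarrow> nat \<Rightarrow> 'v" where
  "nabla_diff h Y k = (Y k - Y (k - 1)) /\<^sub>R h"

definition delta_integral :: "real \<Rightarrow> (nat \<Rightarrow> real) \<Rightarrow> nat \<Rightarrow> real" where
  "delta_integral h F n = (\<Sum>i<n. h * F i)"

text \<open>The composition F(T, X, \<Delta>X), for F = L and for its partial gradients.\<close>

definition along ::
  "real \<Rightarrow> real \<Rightarrow> nat \<Rightarrow> (real \<Rightarrow> 'v \<Rightarrow> 'v \<Rightarrow> 'w) \<Rightarrow> (nat \<Rightarrow> 'v::real_vector) \<Rightarrow> nat \<Rightarrow> 'w" where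
  "along a b N F X k =
     F (grid_point a b N k) (X k) (delta_diff (grid_step a b N) X k)"

definition gradient :: "('v::real_inner \<Rightarrow> real) \<Rightarrow> 'v \<Rightarrow> 'v" where
  "gradient f x = (THE D. GDERIV f x :> D)"

definition grad_x :: "(real \<Rightarrow> 'v \<Rightarrow> 'v \<Rightarrow> real) \<Rightarrow> real \<Rightarrow> 'v::real_inner \<Rightarrow> 'v \<Rightarrow> 'v" where
  "grad_x L t x v = gradient (\<lambda>x'. L t x' v) x"

definition grad_v :: "(real \<Rightarrow> 'v \<Rightarrow> 'v \<Rightarrow> real) \<Rightarrow> real \<Rightarrow> 'v::real_inner \<Rightarrow> 'v \<Rightarrow> 'v" where
  "grad_v L t x v = gradient (\<lambda>v'. L t x v') v"

text \<open>
  Admissibility is taken to be the existence, for each t in [a, b], of a first-order Taylor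
  expansion of L in the pair (x, v) at every point, i.e. joint Frechet differentiability. No
  continuity of the partial gradients and no regularity in t is required, and values of L for
  t outside [a, b] are irrelevant.
\<close>

definition admissible_lagrangian ::
  "real \<Rightarrow> real \<Rightarrow> (real \<Rightarrow> 'v::real_normed_vector \<Rightarrow> 'v \<Rightarrow> real) \<Rightarrow> bool" where
  "admissible_lagrangian a b L \<longleftrightarrow>
     (\<forall>t\<in>{a..b}. \<forall>x v. (\<lambda>(x', v'). L t x' v') differentiable at (x, v))"

definition discrete_functional ::
  "real \<Rightarrow> real \<Rightarrow> nat \<Rightarrow> (real \<Rightarrow> 'v \<Rightarrow> 'v \<Rightarrow> real) \<Rightarrow> (nat \<Rightarrow> 'v::real_vector) \<Rightarrow> real" where
  "discrete_functional a b N L X = delta_integral (grid_step a b N) (along a b N L X) N"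

definition discrete_variations :: "nat \<Rightarrow> (nat \<Rightarrow> 'v::zero) set" where
  "discrete_variations N = {H. H 0 = 0 \<and> H N = 0}"

text \<open>
  A relation rather than a function, so that a statement about the value of the derivative
  includes that the limit exists.
\<close>

definition has_derivative_along ::
  "((nat \<Rightarrow> 'v::real_vector) \<Rightarrow> real) \<Rightarrow> (nat \<Rightarrow> 'v) \<Rightarrow> (nat \<Rightarrow> 'v) \<Rightarrow> real \<Rightarrow> bool" where
  "has_derivative_along \<Phi> X H D \<longleftrightarrow>
     ((\<lambda>\<epsilon>. (1 / \<epsilon>) * (\<Phi> (\<lambda>k. X k + \<epsilon> *\<^sub>R H k) - \<Phi> X)) \<longlongrightarrow> D) (at 0)"

definition critical_point ::
  "nat \<Rightarrow> ((nat \<Rightarrow> 'v::real_vector) \<Rightarrow> real) \<Rightarrow> (nat \<Rightarrow> 'v) \<Rightarrow> bool" where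
  "critical_point N \<Phi> X \<longleftrightarrow> (\<forall>H\<in>discrete_variations N. has_derivative_along \<Phi> X H 0)"

end

theory Submission imports Defs begin

text \<open>
  Along a line \<open>X + \<epsilon> H\<close> the functional is a finite sum of values of \<open>L\<close>, so the chain rule
  gives its derivative at \<open>\<epsilon> = 0\<close>: the sum of \<open>h (H \<bullet> \<partial>L/\<partial>x + \<Delta>H \<bullet> \<partial>L/\<partial>v)\<close>. Since \<open>H\<close> vanishes
  at both ends, discrete summation by parts moves the forward difference off \<open>H\<close> and turns it into
  minus the backward difference of \<open>\<partial>L/\<partial>v\<close> at the interior points
  (\<open>first_variation_discrete_functional\<close>). The first variation is thus \<open>h\<close> times the sum over the
  interior points of the inner products of \<open>H\<close> with the Euler--Lagrange residual. The interior
  values of \<open>H\<close> are arbitrary, and taking them equal to the residual forces the residual to vanish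
  (\<open>discrete_fundamental_lemma\<close>).

  The analytic input is that a jointly differentiable function has both partial gradients and that
  these represent its total derivative (\<open>has_derivative_partial_gradients\<close>).
\<close>

lemma gradient_eqI:
  assumes "GDERIV f x :> D"
  shows "gradient f x = D"
proof -
  have "E = D" if "GDERIV f x :> E" for E
  proof -
    have "(\<lambda>h. h \<bullet> E) = (\<lambda>h. h \<bullet> D)"
      using assms that unfolding gderiv_def by (rule has_derivative_unique[rotated])
    then show ?thesis
      by (metis inner_commute vector_eq_ldot)
  qed
  with assms show ?thesis
    unfolding gradient_def by (intro the_equality)
qed

text \<open>
  In a Euclidean space every linear functional is an inner product with a fixed vector, namely
  the image of 1 under its adjoint.
\<close>

lemma has_derivative_imp_inner_gradient:
  fixes f :: "'v::euclidean_space \<Rightarrow> real"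
  assumes "(f has_derivative f') (at x)"
  shows "f' h = h \<bullet> gradient f x"
proof -
  have "linear f'"
    using assms by (rule has_derivative_linear)
  then have "f' = (\<lambda>h. h \<bullet> adjoint f' 1)"
    by (simp add: fun_eq_iff adjoint_works)
  then obtain D where f': "f' = (\<lambda>h. h \<bullet> D)"
    by blast
  with assms have "gradient f x = D"
    by (intro gradient_eqI) (simp add: gderiv_def)
  with f' show ?thesis
    by simp
qed

lemma has_derivative_partial_gradients:
  fixes F :: "'v::euclidean_space \<Rightarrow> 'w::euclidean_space \<Rightarrow> real"
  assumes "(\<lambda>(x', v'). F x' v') differentiable at (x, v)"
  shows "((\<lambda>(x', v'). F x' v') has_derivative
           (\<lambda>(p, q). p \<bullet> gradient (\<lambda>x'. F x' v) x + q \<bullet> gradient (\<lambda>v'. F x v') v)) (at (x, v))"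
proof -
  obtain F' where F': "((\<lambda>(x', v'). F x' v') has_derivative F') (at (x, v))"
    using assms unfolding differentiable_def by blast
  have "((\<lambda>x'. (x', v)) has_derivative (\<lambda>p. (p, 0))) (at x)"
    by (auto intro!: derivative_eq_intros)
  from diff_chain_at[OF this F'] have "((\<lambda>x'. F x' v) has_derivative (\<lambda>p. F' (p, 0))) (at x)"
    by (simp add: o_def)
  then have x: "F' (p, 0) = p \<bullet> gradient (\<lambda>x'. F x' v) x" for p
    by (rule has_derivative_imp_inner_gradient)
  have "((\<lambda>v'. (x, v')) has_derivative (\<lambda>q. (0, q))) (at v)"
    by (auto intro!: derivative_eq_intros)
  from diff_chain_at[OF this F'] have "((\<lambda>v'. F x v') has_derivative (\<lambda>q. F' (0, q))) (at v)"
    by (simp add: o_def)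
  then have v: "F' (0, q) = q \<bullet> gradient (\<lambda>v'. F x v') v" for q
    by (rule has_derivative_imp_inner_gradient)
  have "F' (p, q) = p \<bullet> gradient (\<lambda>x'. F x' v) x + q \<bullet> gradient (\<lambda>v'. F x v') v" for p q
    using linear_add[OF has_derivative_linear[OF F'], of "(p, 0)" "(0, q)"] by (simp add: x v)
  then have "F' = (\<lambda>(p, q). p \<bullet> gradient (\<lambda>x'. F x' v) x + q \<bullet> gradient (\<lambda>v'. F x v') v)"
    by (simp add: fun_eq_iff)
  with F' show ?thesis
    by simp
qed

lemma grid_step_pos: "a < b \<Longrightarrow> N \<ge> 1 \<Longrightarrow> grid_step a b N > 0"
  by (simp add: grid_step_def)

lemma grid_point_in_interval:
  assumes "a < b" and "k \<le> N"
  shows "grid_point a b N k \<in> {a..b}"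
proof (cases "N = 0")
  case False
  from assms False have "real k * (b - a) \<le> real N * (b - a)"
    by (intro mult_right_mono) auto
  with False have "real k * ((b - a) / real N) \<le> b - a"
    by (simp add: field_simps)
  with assms show ?thesis
    by (simp add: grid_point_def grid_step_def)
qed (use assms in \<open>simp add: grid_point_def grid_step_def\<close>)

lemma delta_diff_add_scaleR:
  "delta_diff h (\<lambda>k. X k + c *\<^sub>R H k) k = delta_diff h X k + c *\<^sub>R delta_diff h H k"
  by (simp add: delta_diff_def algebra_simps)

text \<open>
  Passing from \<open>N\<close> to \<open>N + 1\<close> adds to the left-hand side \<open>1 / h\<close> times the amount
  \<open>(H (N + 1) - H N) \<bullet> Y N + H N \<bullet> (Y N - Y (N - 1)) = H (N + 1) \<bullet> Y N - H N \<bullet> Y (N - 1)\<close>,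
  so the sum telescopes.
\<close>

lemma summation_by_parts:
  fixes H Y :: "nat \<Rightarrow> 'v::real_inner"
  assumes "N \<ge> 1"
  shows "(\<Sum>k<N. delta_diff h H k \<bullet> Y k) + (\<Sum>k\<in>{1..<N}. H k \<bullet> nabla_diff h Y k)
           = (H N \<bullet> Y (N - 1) - H 0 \<bullet> Y 0) / h"
  using assms
proof (induction N rule: dec_induct)
  case base
  show ?case
    by (simp add: delta_diff_def inner_diff_left divide_inverse)
next
  case (step n)
  have "(H n \<bullet> Y (n - 1) - H 0 \<bullet> Y 0) / h + delta_diff h H n \<bullet> Y n + H n \<bullet> nabla_diff h Y n
          = (H (Suc n) \<bullet> Y n - H 0 \<bullet> Y 0) / h"
    by (simp add: delta_diff_def nabla_diff_def inner_diff_left inner_diff_right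
        divide_inverse algebra_simps)
  with step show ?case
    by (simp add: atLeastLessThanSuc)
qed

text \<open>
  Testing with \<open>H = E\<close> at the interior points, extended by 0, turns the sum into a sum of squares.
\<close>

lemma discrete_fundamental_lemma:
  fixes E :: "nat \<Rightarrow> 'v::real_inner"
  shows "(\<forall>H\<in>discrete_variations N. (\<Sum>k\<in>{1..<N}. H k \<bullet> E k) = 0)
           \<longleftrightarrow> (\<forall>k\<in>{1..<N}. E k = 0)"
proof
  assume *: "\<forall>H\<in>discrete_variations N. (\<Sum>k\<in>{1..<N}. H k \<bullet> E k) = 0"
  define H where "H k = (if k \<in> {1..<N} then E k else 0)" for k
  have "H \<in> discrete_variations N"
    by (simp add: discrete_variations_def H_def)
  with * have "(\<Sum>k\<in>{1..<N}. H k \<bullet> E k) = 0"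
    by blast
  then have "(\<Sum>k\<in>{1..<N}. E k \<bullet> E k) = 0"
    by (simp add: H_def)
  then show "\<forall>k\<in>{1..<N}. E k = 0"
    by (subst (asm) sum_nonneg_eq_0_iff) auto
qed simp

lemma has_derivative_along_iff_DERIV:
  "has_derivative_along \<Phi> X H D \<longleftrightarrow> DERIV (\<lambda>\<epsilon>. \<Phi> (\<lambda>k. X k + \<epsilon> *\<^sub>R H k)) 0 :> D"
  by (simp add: has_derivative_along_def DERIV_def)

text \<open>
  Uniqueness of limits makes the statement an equivalence, which is what is needed to read
  criticality as the vanishing of an explicit sum.
\<close>

lemma first_variation_discrete_functional:
  fixes L :: "real \<Rightarrow> 'v::euclidean_space \<Rightarrow> 'v \<Rightarrow> real"
  assumes ab: "a < b" and N: "N \<ge> 1" and L: "admissible_lagrangian a b L"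
    and H: "H \<in> discrete_variations N"
  shows "has_derivative_along (discrete_functional a b N L) X H D \<longleftrightarrow>
    D = grid_step a b N * (\<Sum>k\<in>{1..<N}. H k \<bullet>
          (along a b N (grad_x L) X k - nabla_diff (grid_step a b N) (along a b N (grad_v L) X) k))"
    (is "_ \<longleftrightarrow> D = ?D")
proof -
  let ?h = "grid_step a b N"
  let ?P = "along a b N (grad_x L) X" and ?Q = "along a b N (grad_v L) X"
  have term_deriv: "((\<lambda>\<epsilon>. along a b N L (\<lambda>k. X k + \<epsilon> *\<^sub>R H k) i) has_real_derivative
      H i \<bullet> ?P i + delta_diff ?h H i \<bullet> ?Q i) (at 0)" if "i < N" for i
  proof -
    let ?t = "grid_point a b N i"
    let ?line = "\<lambda>\<epsilon>. (X i + \<epsilon> *\<^sub>R H i, delta_diff ?h X i + \<epsilon> *\<^sub>R delta_diff ?h H i)"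
    have "?t \<in> {a..b}"
      using ab that by (intro grid_point_in_interval) auto
    with L have "(\<lambda>(x', v'). L ?t x' v') differentiable at (X i, delta_diff ?h X i)"
      by (simp add: admissible_lagrangian_def)
    then have "((\<lambda>(x', v'). L ?t x' v') has_derivative (\<lambda>(p, q). p \<bullet> ?P i + q \<bullet> ?Q i)) (at (?line 0))"
      using has_derivative_partial_gradients by (simp add: along_def grad_x_def grad_v_def)
    moreover have "(?line has_derivative (\<lambda>\<epsilon>. (\<epsilon> *\<^sub>R H i, \<epsilon> *\<^sub>R delta_diff ?h H i))) (at 0)"
      by (auto intro!: derivative_eq_intros)
    ultimately have "((\<lambda>(x', v'). L ?t x' v') \<circ> ?line has_derivative
        (\<lambda>(p, q). p \<bullet> ?P i + q \<bullet> ?Q i) \<circ> (\<lambda>\<epsilon>. (\<epsilon> *\<^sub>R H i, \<epsilon> *\<^sub>R delta_diff ?h H i))) (at 0)"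
      by (intro diff_chain_at)
    moreover have "(\<lambda>(x', v'). L ?t x' v') \<circ> ?line = (\<lambda>\<epsilon>. along a b N L (\<lambda>k. X k + \<epsilon> *\<^sub>R H k) i)"
      by (simp add: fun_eq_iff along_def delta_diff_add_scaleR)
    moreover have "(\<lambda>(p, q). p \<bullet> ?P i + q \<bullet> ?Q i) \<circ> (\<lambda>\<epsilon>. (\<epsilon> *\<^sub>R H i, \<epsilon> *\<^sub>R delta_diff ?h H i))
        = (*) (H i \<bullet> ?P i + delta_diff ?h H i \<bullet> ?Q i)"
      by (simp add: fun_eq_iff algebra_simps)
    ultimately show ?thesis
      unfolding has_field_derivative_def by (simp only:)
  qed
  have deriv: "DERIV (\<lambda>\<epsilon>. discrete_functional a b N L (\<lambda>k. X k + \<epsilon> *\<^sub>R H k)) 0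
      :> (\<Sum>i<N. ?h * (H i \<bullet> ?P i + delta_diff ?h H i \<bullet> ?Q i))"
    unfolding discrete_functional_def delta_integral_def
    by (intro DERIV_sum DERIV_cmult term_deriv) auto
  have ends: "H 0 = 0" "H N = 0"
    using H by (auto simp: discrete_variations_def)
  have "(\<Sum>i<N. H i \<bullet> ?P i) = (\<Sum>k\<in>{1..<N}. H k \<bullet> ?P k)"
    by (intro sum.mono_neutral_right) (use ends in \<open>auto simp: not_le\<close>)
  moreover have "(\<Sum>i<N. delta_diff ?h H i \<bullet> ?Q i) = - (\<Sum>k\<in>{1..<N}. H k \<bullet> nabla_diff ?h ?Q k)"
    using summation_by_parts[OF N, of ?h H ?Q] ends by simp
  ultimately have "(\<Sum>i<N. ?h * (H i \<bullet> ?P i + delta_diff ?h H i \<bullet> ?Q i)) = ?D"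
    by (simp only: sum_distrib_left[symmetric] sum.distrib inner_diff_right sum_subtractf) simp
  with deriv have *: "DERIV (\<lambda>\<epsilon>. discrete_functional a b N L (\<lambda>k. X k + \<epsilon> *\<^sub>R H k)) 0 :> ?D"
    by (simp only:)
  show ?thesis
    unfolding has_derivative_along_iff_DERIV
  proof
    show "D = ?D" if "DERIV (\<lambda>\<epsilon>. discrete_functional a b N L (\<lambda>k. X k + \<epsilon> *\<^sub>R H k)) 0 :> D"
      using that * by (rule DERIV_unique)
  qed (use * in \<open>simp only:\<close>)
qed

theorem theorem31:
  fixes a b :: real and N :: nat
    and L :: "real \<Rightarrow> real ^ 'd \<Rightarrow> real ^ 'd \<Rightarrow> real"
    and X :: "nat \<Rightarrow> real ^ 'd"
  assumes "a < b" and "N \<ge> 1"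
    and "admissible_lagrangian a b L"
  shows "critical_point N (discrete_functional a b N L) X \<longleftrightarrow>
    (\<forall>k\<in>{1..<N}. nabla_diff (grid_step a b N) (along a b N (grad_v L) X) k
                   = along a b N (grad_x L) X k)"
proof -
  let ?E = "\<lambda>k. along a b N (grad_x L) X k
                - nabla_diff (grid_step a b N) (along a b N (grad_v L) X) k"
  have "critical_point N (discrete_functional a b N L) X \<longleftrightarrow>
      (\<forall>H\<in>discrete_variations N. (\<Sum>k\<in>{1..<N}. H k \<bullet> ?E k) = 0)"
    using first_variation_discrete_functional[OF assms] grid_step_pos[OF assms(1,2)]
    by (simp add: critical_point_def)
  also have "\<dots> \<longleftrightarrow> (\<forall>k\<in>{1..<N}. ?E k = 0)"
    by (rule discrete_fundamental_lemma)
  also have "\<dots> \<longleftrightarrow> (\<forall>k\<in>{1..<N}. nabla_diff (grid_step a b N) (along a b N (grad_v L) X) k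
                   = along a b N (grad_x L) X k)"
    by (intro ball_cong) auto
  finally show ?thesis .
qed

end
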